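(* Consider the two-player zero-sum vector-valued game in which player 1 has pure strategies $a_1, a_2$, player 2 has pure strategies $b_1, b_2$, and the (common) payoff $u(a_i, b_j) \in \mathbb{R}^3$ is given by $$u(a_1,b_1) = (0.1, 0.8, 0.1),\quad u(a_1,b_2) = (0.1, 0.7, 0.2),\quad u(a_2,b_1) = (0.6, 0.1, 0.3),\quad u(a_2,b_2) = (0.8, 0.1, 0.1).$$ Player 1 prefers larger payoffs with respect to the reflected lexicographic order $\leq_{\text{Rlex}}$, and player 2 prefers smaller payoffs with respect to $\leq_{\text{Rlex}}$. Then the mixed extension of this game has no Nash equilibrium, i.e. there are no mixed strategies $s_1 \in \Delta_1$, $s_2 \in \Delta_2$ such that $u(\tilde{s}_1, s_2) \leq_{\text{Rlex}} u(s_1, s_2)$ for all $\tilde{s}_1 \in \Delta_1$ and $u(s_1, s_2) \leq_{\text{Rlex}} u(s_1, \tilde{s}_2)$ for all $\tilde{s}_2 \in \Delta_2$.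
   Context: The reflected lexicographic order on $\mathbb{R}^m$: $x \leq_{\text{Rlex}} y$ iff $x = y$ or there is $k \in \{1,\dots,m\}$ with $x_k < y_k$ and $x_i = y_i$ for all $i > k$. $\Delta_k$ is the set of mixed strategies (probability distributions on the pure strategies) of player $k$; payoffs are extended to mixed strategies by $u(s_1,s_2) = \sum_{i,j} s_1(a_i)\, s_2(b_j)\, u(a_i,b_j) \in \mathbb{R}^3$. *)

theory Defs
  imports "HOL-Analysis.Analysis"
begin

text \<open>
  The coordinates of a vector in \<open>real ^ 'm\<close>, for a numeral type \<open>'m\<close> such as \<open>3\<close>, are taken in
  the order \<open>1, 2, \<dots>, CARD('m)\<close>.  The order on the type \<open>'m\<close> itself cannot be used, because
  there \<open>CARD('m)\<close> coincides with \<open>0\<close> and is the least index.  Hence the comparison of indices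
  takes place in \<open>nat\<close>.
\<close>

definition rlex_le :: "(real, 'm::{finite, comm_ring_1}) vec \<Rightarrow> (real, 'm) vec \<Rightarrow> bool"
    (infix "\<le>\<^sub>R\<^sub>l\<^sub>e\<^sub>x" 50) where
  "x \<le>\<^sub>R\<^sub>l\<^sub>e\<^sub>x y \<longleftrightarrow>
     x = y \<or>
     (\<exists>k\<in>{1..CARD('m)}. x $ of_nat k < y $ of_nat k \<and>
        (\<forall>i\<in>{1..CARD('m)}. i > k \<longrightarrow> x $ of_nat i = y $ of_nat i))"

definition mixed_strategies :: "('a::finite \<Rightarrow> real) set" where
  "mixed_strategies = {s. (\<forall>a. 0 \<le> s a) \<and> (\<Sum>a\<in>UNIV. s a) = 1}"

definition mixed_payoff ::
    "('a::finite \<Rightarrow> 'b::finite \<Rightarrow> 'v::real_vector) \<Rightarrow> ('a \<Rightarrow> real) \<Rightarrow> ('b \<Rightarrow> real) \<Rightarrow> 'v" where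
  "mixed_payoff u s1 s2 = (\<Sum>a\<in>UNIV. \<Sum>b\<in>UNIV. (s1 a * s2 b) *\<^sub>R u a b)"

text \<open>Player 1 maximises and player 2 minimises the common payoff \<open>u\<close>.\<close>

definition mixed_nash_equilibrium ::
    "('a::finite \<Rightarrow> 'b::finite \<Rightarrow> (real, 'm::{finite, comm_ring_1}) vec) \<Rightarrow>
     ('a \<Rightarrow> real) \<Rightarrow> ('b \<Rightarrow> real) \<Rightarrow> bool" where
  "mixed_nash_equilibrium u s1 s2 \<longleftrightarrow>
     s1 \<in> mixed_strategies \<and> s2 \<in> mixed_strategies \<and>
     (\<forall>t1\<in>mixed_strategies. mixed_payoff u t1 s2 \<le>\<^sub>R\<^sub>l\<^sub>e\<^sub>x mixed_payoff u s1 s2) \<and>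
     (\<forall>t2\<in>mixed_strategies. mixed_payoff u s1 s2 \<le>\<^sub>R\<^sub>l\<^sub>e\<^sub>x mixed_payoff u s1 t2)"

datatype strategy1 = A1 | A2

datatype strategy2 = B1 | B2

lemma UNIV_strategy1: "UNIV = {A1, A2}"
  by (auto intro: strategy1.exhaust)

lemma UNIV_strategy2: "UNIV = {B1, B2}"
  by (auto intro: strategy2.exhaust)

instance strategy1 :: finite
  by standard (simp add: UNIV_strategy1)

instance strategy2 :: finite
  by standard (simp add: UNIV_strategy2)

fun game_payoff :: "strategy1 \<Rightarrow> strategy2 \<Rightarrow> real ^ 3" where
  "game_payoff A1 B1 = vector [0.1, 0.8, 0.1]"
| "game_payoff A1 B2 = vector [0.1, 0.7, 0.2]"
| "game_payoff A2 B1 = vector [0.6, 0.1, 0.3]"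
| "game_payoff A2 B2 = vector [0.8, 0.1, 0.1]"

end

(* Writing p and q for the probabilities of A1 and B1, ten times the third payoff coordinate is
   1 + p + 2q - 3pq.  The real-valued game with this payoff has the unique equilibrium p = 2/3,
   q = 1/3, so this is the only candidate.  At q = 1/3 the third coordinate no longer depends on p,
   while ten times the second one is 1 + 6p + pq, so player 1 gains by deviating to A1. *)

theory Submission
  imports Defs
begin

text \<open>Coordinate 3 is the most significant. The case \<open>x = y\<close> is absorbed into the
  non-strict comparison of coordinate 1.\<close>

lemma rlex_le_3:
  fixes x y :: "real ^ 3"
  shows "x \<le>\<^sub>R\<^sub>l\<^sub>e\<^sub>x y \<longleftrightarrow>
    x $ 3 < y $ 3 \<or> x $ 3 = y $ 3 \<and> (x $ 2 < y $ 2 \<or> x $ 2 = y $ 2 \<and> x $ 1 \<le> y $ 1)"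
proof -
  have "{1..CARD(3)} = {1, 2, 3::nat}"
    by auto
  then show ?thesis
    unfolding rlex_le_def by (auto simp: vec_eq_iff forall_3)
qed

lemma mixed_payoff_game_payoff:
  assumes "s1 \<in> mixed_strategies" "s2 \<in> mixed_strategies"
  shows "mixed_payoff game_payoff s1 s2 $ 2 = (1 + 6 * s1 A1 + s1 A1 * s2 B1) / 10"
    and "mixed_payoff game_payoff s1 s2 $ 3 =
      (1 + s1 A1 + 2 * s2 B1 - 3 * s1 A1 * s2 B1) / 10"
proof -
  have complement: "s1 A2 = 1 - s1 A1" "s2 B2 = 1 - s2 B1"
    using assms by (auto simp: mixed_strategies_def UNIV_strategy1 UNIV_strategy2)
  show "mixed_payoff game_payoff s1 s2 $ 2 = (1 + 6 * s1 A1 + s1 A1 * s2 B1) / 10"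
    and "mixed_payoff game_payoff s1 s2 $ 3 =
      (1 + s1 A1 + 2 * s2 B1 - 3 * s1 A1 * s2 B1) / 10"
    by (simp_all add: mixed_payoff_def UNIV_strategy1 UNIV_strategy2 complement field_simps)
qed

lemma pure_in_mixed_strategies: "(\<lambda>x. if x = a then 1 else 0) \<in> mixed_strategies"
  by (simp add: mixed_strategies_def)

text \<open>For f(p,q) = 1 + p + 2q - 3pq the four products are f(1,q) - f(p,q), f(p,q) - f(0,q),
  f(p,1) - f(p,q) and f(p,q) - f(p,0), so \<open>dev1\<close> and \<open>dev2\<close> exclude gains
  from pure deviations.\<close>

lemma bilinear_game_equilibrium:
  fixes p q :: real
  assumes "0 \<le> p" "p \<le> 1" "0 \<le> q" "q \<le> 1"
    and dev1: "(1 - p) * (1 - 3 * q) \<le> 0" "0 \<le> p * (1 - 3 * q)"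
    and dev2: "0 \<le> (1 - q) * (2 - 3 * p)" "q * (2 - 3 * p) \<le> 0"
  shows "p = 2 / 3 \<and> q = 1 / 3"
proof -
  \<comment> \<open>A positive slope 1 - 3q in p forces p = 1; there the slope in q is -1, which
    would force q = 1.\<close>
  have "\<not> q < 1 / 3"
  proof
    assume "q < 1 / 3"
    then have "p = 1"
      using dev1 assms by (auto simp: mult_le_0_iff)
    with dev2 \<open>q < 1 / 3\<close> show False by simp
  qed
  \<comment> \<open>Now p = 0, where the slope in q is 2, which would force q = 0.\<close>
  moreover have "\<not> 1 / 3 < q"
  proof
    assume "1 / 3 < q"
    then have "p = 0"
      using dev1 assms by (auto simp: zero_le_mult_iff)
    with dev2 \<open>1 / 3 < q\<close> show False by simp
  qed
  ultimately have "q = 1 / 3" by simp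
  \<comment> \<open>Both q and 1 - q are positive, so 2 - 3p has to vanish.\<close>
  with dev2 show ?thesis by simp
qed

theorem mainTheorem7:
  "\<not> (\<exists>(s1 :: strategy1 \<Rightarrow> real) (s2 :: strategy2 \<Rightarrow> real).
        mixed_nash_equilibrium game_payoff s1 s2)"
proof clarify
  fix s1 :: "strategy1 \<Rightarrow> real" and s2 :: "strategy2 \<Rightarrow> real"
  assume eq: "mixed_nash_equilibrium game_payoff s1 s2"
  define p q where "p = s1 A1" and "q = s2 B1"
  have mem: "s1 \<in> mixed_strategies" "s2 \<in> mixed_strategies"
    using eq by (auto simp: mixed_nash_equilibrium_def)
  then have "0 \<le> s1 A1" "0 \<le> s1 A2" "s1 A1 + s1 A2 = 1" "0 \<le> s2 B1" "0 \<le> s2 B2" "s2 B1 + s2 B2 = 1"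
    by (auto simp: mixed_strategies_def UNIV_strategy1 UNIV_strategy2)
  then have bounds: "0 \<le> p" "p \<le> 1" "0 \<le> q" "q \<le> 1"
    by (auto simp: p_def q_def)
  note payoff = mixed_payoff_game_payoff[OF mem, folded p_def q_def]
  have dev1: "mixed_payoff game_payoff (\<lambda>x. if x = a then 1 else 0) s2
      \<le>\<^sub>R\<^sub>l\<^sub>e\<^sub>x mixed_payoff game_payoff s1 s2" for a
    using eq pure_in_mixed_strategies by (auto simp: mixed_nash_equilibrium_def)
  have dev2: "mixed_payoff game_payoff s1 s2
      \<le>\<^sub>R\<^sub>l\<^sub>e\<^sub>x mixed_payoff game_payoff s1 (\<lambda>x. if x = b then 1 else 0)" for b
    using eq pure_in_mixed_strategies by (auto simp: mixed_nash_equilibrium_def)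
  note payoff1 = mixed_payoff_game_payoff[OF pure_in_mixed_strategies mem(2), folded q_def]
  note payoff2 = mixed_payoff_game_payoff[OF mem(1) pure_in_mixed_strategies, folded p_def]
  have "p = 2 / 3 \<and> q = 1 / 3"
  \<comment> \<open>The order \<open>\<le>\<^sub>R\<^sub>l\<^sub>e\<^sub>x\<close> implies \<le> in
    the third coordinate; each pure deviation yields one inequality.\<close>
  proof (rule bilinear_game_equilibrium[OF bounds])
    show "(1 - p) * (1 - 3 * q) \<le> 0"
      using dev1[of A1] unfolding rlex_le_3 payoff payoff1 by (auto simp: field_simps)
    show "0 \<le> p * (1 - 3 * q)"
      using dev1[of A2] unfolding rlex_le_3 payoff payoff1 by (auto simp: field_simps)
    show "0 \<le> (1 - q) * (2 - 3 * p)"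
      using dev2[of B1] unfolding rlex_le_3 payoff payoff2 by (auto simp: field_simps)
    show "q * (2 - 3 * p) \<le> 0"
      using dev2[of B2] mult_nonneg_nonneg[OF bounds(1,3)]
      unfolding rlex_le_3 payoff payoff2 by (auto simp: field_simps)
  qed
  then have equilibrium: "p = 2 / 3" "q = 1 / 3" by simp_all
  \<comment> \<open>Third coordinates tie at 1/6, but ten times the second is 22/3 for
    \<open>A1\<close> against 47/9 for \<open>s1\<close>.\<close>
  show False
    using dev1[of A1] unfolding rlex_le_3 payoff payoff1 equilibrium by simp
qed

end
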